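(* Let $(a_n)_{n=0}^{\infty}\subset S^1$ be a greedy $1$-energy sequence with $a_0=1$, and let $\alpha_{N,1}=(a_0,\ldots,a_{N-1})$, $N\geq 2$. The sequence $$\left(\frac{H_1(\alpha_{N,1})-N^2 I_1(\sigma_1)}{\log N}\right)_{N=2}^{\infty}$$ is bounded and divergent (i.e., not convergent). We have $$\limsup_{N\to\infty}\frac{H_1(\alpha_{N,1})-N^2 I_1(\sigma_1)}{\log N}=0,$$ $$\liminf_{N\to\infty}\frac{H_1(\alpha_{N,1})-N^2 I_1(\sigma_1)}{\log N}\leq-\frac{\pi}{9\log 2}.$$
   Context: $S^1$ is the unit circle, viewed as the set of complex numbers of modulus $1$. A greedy $1$-energy sequence on $S^1$ is a sequence $(a_n)_{n=0}^{\infty}\subset S^1$ such that $\sum_{k=0}^{n-1}|a_n-a_k|=\max_{x\in S^1}\sum_{k=0}^{n-1}|x-a_k|$ for all $n\geq 1$. For a configuration $\omega_N=(y_0,\ldots,y_{N-1})$ of $N\ge2$ points, $H_1(\omega_N)=\sum_{0\le i\neq j\le N-1}|y_i-y_j|$. $\sigma_1$ is the normalized arc-length (uniform probability) measure on $S^1$, and $I_1(\sigma_1)=\iint_{S^1\times S^1}|x-y|\,d\sigma_1(x)\,d\sigma_1(y)$. $\log$ is the natural logarithm. *)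

theory Defs
  imports "HOL-Analysis.Analysis"
begin

(* The maximum over the circle of the sum of the distances to the earlier points
   is attained at a n, where a 0 is an arbitrary point of the circle. *)
definition greedy_energy_seq :: "(nat \<Rightarrow> complex) \<Rightarrow> bool" where
  "greedy_energy_seq a \<longleftrightarrow>
     (\<forall>n. a n \<in> sphere 0 1) \<and>
     (\<forall>n\<ge>1. \<forall>x\<in>sphere 0 1.
        (\<Sum>k<n. norm (x - a k)) \<le> (\<Sum>k<n. norm (a n - a k)))"

(* Ordered pairs: each unordered pair of indices is counted twice.
   The configuration is y 0, ..., y (N - 1). *)
definition H1 :: "nat \<Rightarrow> (nat \<Rightarrow> complex) \<Rightarrow> real" where
  "H1 N y = (\<Sum>(i, j) \<in> {(i, j). i < N \<and> j < N \<and> i \<noteq> j}. norm (y i - y j))"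

(* Normalized arc length, as a measure on the Borel sets of the plane
   concentrated on the unit circle. *)
definition sigma1 :: "complex measure" where
  "sigma1 = distr (uniform_measure lborel {0..2 * pi}) borel cis"

definition I1 :: "complex measure \<Rightarrow> real" where
  "I1 \<mu> = (\<integral>x. (\<integral>y. norm (x - y) \<partial>\<mu>) \<partial>\<mu>)"

(* Meaningful for N at least 2 only; H1 N a depends only on a 0, ..., a (N - 1). *)
definition normalized_energy :: "(nat \<Rightarrow> complex) \<Rightarrow> nat \<Rightarrow> real" where
  "normalized_energy a N = (H1 N a - (real N)\<^sup>2 * I1 sigma1) / ln (real N)"

end

theory Submission
  imports Defs "HOL-Real_Asymp.Real_Asymp"
begin

text \<open>
  The maximum over the circle of the distance sum to a regular \<open>M\<close>-gon is attained exactly at the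
  midpoints of the arcs (\<open>sum_dist_roots_less\<close>). Hence a greedy sequence has a dyadic structure: its
  first \<open>2 ^ m\<close> points form a regular polygon, the next ones are midpoints of its arcs, and these
  later points are themselves a greedy sequence as long as there are at most \<open>2 ^ m\<close> of them
  (\<open>second_block\<close>, \<open>greedy_in_root_coset_power2\<close>).

  Consequently the energy of \<open>2 ^ m + n\<close> points with \<open>n \<le> 2 ^ m\<close> is the energy of the polygon, plus an
  explicit interaction term that is linear in \<open>n\<close>, plus the energy of \<open>n\<close> greedy points. After subtracting
  \<open>N\<^sup>2 * (4 / pi)\<close>, where \<open>4 / pi\<close> is the energy of the uniform measure (\<open>I1_sigma1\<close>), each binary digit \<open>2 ^ m\<close>
  of \<open>N\<close>, followed by the remainder \<open>n\<close>, contributes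
  at least \<open>- pi\<close> and at most \<open>- (pi / 3) * (1 - n / 2 ^ m) + (1 / 4) ^ m\<close> (\<open>excess_greedy_split\<close>).

  Since a remainder is smaller than its leading digit, the excess is bounded above, and since \<open>N\<close> has
  about \<open>log 2 N\<close> digits, it is at least a negative multiple of \<open>ln N\<close>. Powers of two have a single digit and a bounded
  excess, which makes the limit superior \<open>0\<close>. For \<open>N = (4 ^ k - 1) / 3\<close> with digits \<open>1010...01\<close> each
  remainder is about a third of its digit, so the \<open>k\<close> digits contribute at most
  \<open>- (2 * pi / 9) * k\<close> up to a bounded error, while \<open>ln N\<close> is at most \<open>2 * k * ln 2\<close>; this bounds the limit
  inferior by \<open>- pi / (9 * ln 2)\<close>. The limits
  superior and inferior differ, so the sequence diverges.
\<close>

section \<open>Distance sums to the vertices of a regular polygon\<close>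

text \<open>
  Chord length in terms of the angle: this turns every distance sum into a sum of sines.
\<close>
lemma norm_cis_diff: "norm (cis s - cis t) = 2 * \<bar>sin ((s - t) / 2)\<bar>"
proof -
  have "norm (cis s - cis t) = norm (cis t * (cis (s - t) - 1))"
    by (simp add: algebra_simps cis_mult)
  then show ?thesis
    using dist_exp_i_1[of "s - t"] by (simp add: norm_mult cis_conv_exp)
qed

text \<open>
  Multiplying by twice the sine of half the step makes the sum telescope; over half a turn the two
  end terms are opposite, so they add up to a single cosine.
\<close>
lemma sum_sin_half_turn:
  assumes "N > 0"
  shows "(\<Sum>k<N. sin (\<phi> + pi * real k / real N)) = cos (\<phi> - pi / (2 * real N)) / sin (pi / (2 * real N))"
proof -
  define h where "h = pi / (2 * real N)"
  have h: "0 < h" "h < pi" "2 * h * real N = pi"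
    using assms by (auto simp: h_def field_simps)
  have "sin h > 0" using h by (intro sin_gt_zero)
  define g where "g k = cos (\<phi> - h + 2 * h * real k)" for k
  have step: "2 * sin h * sin (\<phi> + pi * real k / real N) = g k - g (Suc k)" for k
  proof -
    have A: "\<phi> + pi * real k / real N = \<phi> + 2 * h * real k"
      using assms by (simp add: h_def)
    have "g k = cos ((\<phi> + 2 * h * real k) - h)" "g (Suc k) = cos ((\<phi> + 2 * h * real k) + h)"
      by (simp_all add: g_def algebra_simps)
    then show ?thesis unfolding A by (simp add: cos_diff cos_add)
  qed
  have "2 * sin h * (\<Sum>k<N. sin (\<phi> + pi * real k / real N)) = g 0 - g N"
    by (simp add: sum_distrib_left step sum_lessThan_telescope')
  also have "\<dots> = 2 * cos (\<phi> - h)"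
    unfolding g_def h(3) by simp
  finally show ?thesis
    using \<open>sin h > 0\<close> unfolding h_def by (simp add: field_simps)
qed

text \<open>
  The distance sum from \<open>x\<close> to a rotated set of \<open>N\<close>-th roots of unity. The angle \<open>\<phi>\<close>, which
  compares \<open>N\<close>-th powers, says where \<open>x\<close> lies in its arc between two neighbouring points: \<open>\<phi> = 0\<close>
  and \<open>\<phi> = 2 * pi\<close> are the end points, \<open>\<phi> = pi\<close> is the midpoint. Seen from \<open>x\<close>, the half-angles of the chords
  form an arithmetic progression inside \<open>[0, pi]\<close>, so the absolute values of the sines can be dropped.
\<close>
lemma sum_dist_roots:
  fixes x :: complex
  assumes "N > 0" "norm x = 1" "0 \<le> \<phi>" "\<phi> \<le> 2 * pi"
  shows "(\<Sum>z | z ^ N = x ^ N * cis \<phi>. norm (x - z))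
    = 2 * cos ((\<phi> - pi) / (2 * real N)) / sin (pi / (2 * real N))"
proof -
  define y where "y = x * cis (\<phi> / N)"
  have "x \<noteq> 0" using assms by auto
  then have y: "y \<noteq> 0" "y ^ N = x ^ N * cis \<phi>"
    using assms(1) by (auto simp: y_def power_mult_distrib Complex.DeMoivre)
  have "bij_betw (\<lambda>\<zeta>. y * \<zeta>) {\<zeta>. \<zeta> ^ N = 1} {z. z ^ N = x ^ N * cis \<phi>}"
    by (rule bij_betw_byWitness[where f' = "\<lambda>z. z / y"])
       (use y \<open>x \<noteq> 0\<close> in \<open>auto simp: power_mult_distrib power_divide\<close>)
  from bij_betw_trans[OF Complex.bij_betw_roots_unity[OF assms(1)] this]
  have "(\<Sum>z | z ^ N = x ^ N * cis \<phi>. norm (x - z))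
      = (\<Sum>k<N. norm (x - y * cis (2 * pi * real k / real N)))"
    by (subst sum.reindex_bij_betw[symmetric, where h = "\<lambda>k. y * cis (2 * pi * real k / real N)"])
       (auto simp: o_def)
  also have "\<dots> = (\<Sum>k<N. 2 * sin (\<phi> / (2 * real N) + pi * real k / real N))"
  proof (intro sum.cong refl)
    fix k assume k: "k \<in> {..<N}"
    define t where "t = \<phi> / N + 2 * pi * real k / real N"
    have "x - y * cis (2 * pi * real k / real N) = x * (cis 0 - cis t)"
      by (simp add: y_def t_def algebra_simps cis_mult)
    then have *: "norm (x - y * cis (2 * pi * real k / real N)) = 2 * \<bar>sin (t / 2)\<bar>"
      using norm_cis_diff[of 0 t] assms(2) by (simp add: norm_mult)
    have "t = (\<phi> + 2 * pi * real k) / real N" by (simp add: t_def add_divide_distrib)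
    also have "\<dots> \<le> (2 * pi + 2 * pi * real (N - 1)) / real N"
      using k assms by (intro divide_right_mono add_mono mult_left_mono) auto
    also have "\<dots> = 2 * pi" using assms(1) by (simp add: field_simps of_nat_diff)
    finally have "sin (t / 2) \<ge> 0"
      using assms by (intro sin_ge_zero) (auto simp: t_def)
    then show "norm (x - y * cis (2 * pi * real k / real N)) = 2 * sin (\<phi> / (2 * real N) + pi * real k / real N)"
      unfolding * by (simp add: t_def add_divide_distrib mult.commute)
  qed
  also have "\<dots> = 2 * cos ((\<phi> - pi) / (2 * real N)) / sin (pi / (2 * real N))"
    using sum_sin_half_turn[OF assms(1), of "\<phi> / (2 * real N)"]
    by (simp add: sum_distrib_left[symmetric] diff_divide_distrib)
  finally show ?thesis .
qed

lemma sum_dist_roots_at_root: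
  assumes "N > 0" "norm (x :: complex) = 1" "x ^ N = w"
  shows "(\<Sum>z | z ^ N = w. norm (x - z)) = 2 * cos (pi / (2 * real N)) / sin (pi / (2 * real N))"
  using sum_dist_roots[OF assms(1,2), of 0] assms(3) by simp

lemma sum_dist_roots_at_midpoint:
  assumes "N > 0" "norm (x :: complex) = 1" "x ^ N = - w"
  shows "(\<Sum>z | z ^ N = w. norm (x - z)) = 2 / sin (pi / (2 * real N))"
  using sum_dist_roots[OF assms(1,2), of pi] assms(3) by simp

text \<open>
  Together with the previous lemma: the distance sum attains its maximum exactly at the midpoints of
  the arcs, which are the solutions of \<open>x ^ N = - w\<close>.
\<close>
lemma sum_dist_roots_less:
  assumes "N > 0" "norm (x :: complex) = 1" "norm w = 1" "x ^ N \<noteq> - w"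
  shows "(\<Sum>z | z ^ N = w. norm (x - z)) < 2 / sin (pi / (2 * real N))"
proof -
  define \<phi> where "\<phi> = Arg2pi (w / x ^ N)"
  have "x \<noteq> 0" using assms by auto
  have "norm (w / x ^ N) = 1" using assms by (simp add: norm_divide norm_power)
  then have "w / x ^ N = cis \<phi>"
    using Arg2pi_eq[of "w / x ^ N"] by (simp add: \<phi>_def cis_conv_exp)
  then have w: "w = x ^ N * cis \<phi>" using \<open>x \<noteq> 0\<close> by (simp add: field_simps)
  have \<phi>: "0 \<le> \<phi>" "\<phi> < 2 * pi" by (auto simp: \<phi>_def Arg2pi_ge_0 Arg2pi_lt_2pi)
  have "\<phi> \<noteq> pi" using assms(4) w by auto
  have pos: "sin (pi / (2 * real N)) > 0"
    using assms(1) by (intro sin_gt_zero) (auto simp: field_simps)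
  have "\<bar>(\<phi> - pi) / (2 * real N)\<bar> \<le> \<bar>\<phi> - pi\<bar>"
    using assms(1) mult_right_mono[of 1 "2 * real N" "\<bar>\<phi> - pi\<bar>"]
    by (simp add: abs_divide field_simps)
  also have "\<dots> \<le> pi" using \<phi> by (auto simp: abs_if)
  finally have "cos \<bar>(\<phi> - pi) / (2 * real N)\<bar> < cos 0"
    using assms(1) \<open>\<phi> \<noteq> pi\<close> by (intro cos_monotone_0_pi) auto
  then have "cos ((\<phi> - pi) / (2 * real N)) < 1" by (simp only: cos_abs_real cos_zero)
  then show ?thesis
    using sum_dist_roots[OF assms(1,2), of \<phi>] \<phi> pos unfolding w[symmetric]
    by (simp add: divide_strict_right_mono)
qed

section \<open>Greedy points are roots of unity\<close>

text \<open>
  The finite initial segments are needed as objects of their own: the second half of a greedy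
  block of length \<open>2 * M\<close> is again greedy, but only as far as the block reaches. The condition at
  \<open>n = 0\<close> compares empty sums, so the first point is arbitrary.
\<close>
definition greedy_upto :: "nat \<Rightarrow> (nat \<Rightarrow> complex) \<Rightarrow> bool" where
  "greedy_upto N a \<longleftrightarrow> (\<forall>n<N. norm (a n) = 1 \<and>
     (\<forall>x. norm x = 1 \<longrightarrow> (\<Sum>k<n. norm (x - a k)) \<le> (\<Sum>k<n. norm (a n - a k))))"

lemma greedy_upto_mono: "greedy_upto N a \<Longrightarrow> M \<le> N \<Longrightarrow> greedy_upto M a"
  by (auto simp: greedy_upto_def)

lemma greedy_upto_cong:
  assumes "\<And>k. k < N \<Longrightarrow> a k = b k"
  shows "greedy_upto N a \<longleftrightarrow> greedy_upto N b"
  unfolding greedy_upto_def using assms by (intro all_cong imp_cong conj_cong) auto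

lemma sum_lessThan_add:
  fixes f :: "nat \<Rightarrow> 'a::comm_monoid_add"
  shows "(\<Sum>i<m + n. f i) = (\<Sum>i<m. f i) + (\<Sum>i<n. f (m + i))"
  by (induction n) (auto simp: add.assoc)

lemma sum_dist_attains_max:
  fixes b :: "nat \<Rightarrow> complex"
  obtains y where "norm y = 1" "\<And>x. norm x = 1 \<Longrightarrow> (\<Sum>j<k. norm (x - b j)) \<le> (\<Sum>j<k. norm (y - b j))"
proof -
  have "\<exists>y\<in>sphere 0 1. \<forall>x\<in>sphere 0 1. (\<Sum>j<k. norm (x - b j)) \<le> (\<Sum>j<k. norm (y - b j))"
    by (intro continuous_attains_sup continuous_intros) (auto intro: exI[of _ 1])
  then show ?thesis using that by auto
qed

text \<open>
  The structural fact that is proved for \<open>M = 2 ^ m\<close> by induction on \<open>m\<close>: up to length \<open>M\<close> every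
  greedy sequence consists of distinct points of the set of \<open>M\<close>-th roots of unity rotated
  by the first point. Equality of \<open>M\<close>-th powers expresses this without choosing an enumeration.
\<close>
definition greedy_in_root_coset :: "nat \<Rightarrow> bool" where
  "greedy_in_root_coset M \<longleftrightarrow> (\<forall>N a. N \<le> M \<longrightarrow> greedy_upto N a \<longrightarrow>
     inj_on a {..<N} \<and> (\<forall>k<N. a k ^ M = a 0 ^ M))"

text \<open>
  Distinct points that fill a set up to its cardinality exhaust it, so their order is irrelevant
  for every sum over the block.
\<close>
lemma first_block:
  assumes "greedy_in_root_coset M" "M > 0" "greedy_upto M a"
  shows "a ` {..<M} = {z. z ^ M = a 0 ^ M}" "inj_on a {..<M}"
proof -
  have r: "inj_on a {..<M}" "\<And>k. k < M \<Longrightarrow> a k ^ M = a 0 ^ M"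
    using assms unfolding greedy_in_root_coset_def by blast+
  show "inj_on a {..<M}" by fact
  have "a 0 \<noteq> 0" using assms(2,3) by (auto simp: greedy_upto_def)
  show "a ` {..<M} = {z. z ^ M = a 0 ^ M}"
  proof (rule card_subset_eq)
    show "finite {z. z ^ M = a 0 ^ M}" using assms(2) by (rule finite_nth_roots)
    show "a ` {..<M} \<subseteq> {z. z ^ M = a 0 ^ M}" using r(2) by blast
    show "card (a ` {..<M}) = card {z. z ^ M = a 0 ^ M}"
      using assms(2) \<open>a 0 \<noteq> 0\<close> by (simp add: card_image[OF r(1)] card_nth_roots)
  qed
qed

lemma sum_first_block:
  assumes "greedy_in_root_coset M" "M > 0" "greedy_upto M a"
  shows "(\<Sum>k<M. f (a k)) = (\<Sum>z | z ^ M = a 0 ^ M. f z)"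
  using first_block[OF assms] by (metis sum.reindex_cong)

text \<open>
  Why a greedy sequence restarts after a full block of \<open>M\<close> points. The sum to be maximized is
  \<open>V + f\<close>, where \<open>V\<close> belongs to the full block and \<open>f\<close> to the points chosen after it. The maximizers
  of \<open>V\<close> are the midpoints, the solutions of \<open>y ^ M = - w\<close>. By the structural fact for \<open>M\<close>, the maximum of
  \<open>f\<close> is attained in the coset of the later points, which consists of midpoints. So both maxima are
  attained at a common point, and therefore every maximizer of \<open>V + f\<close> maximizes \<open>V\<close> and \<open>f\<close> separately:
  it is a midpoint, and it is a greedy continuation of the later points alone.
\<close>
lemma second_block:
  assumes "greedy_in_root_coset M" "M > 0" "greedy_upto (M + n) a" "n \<le> M"
  shows "greedy_upto n (\<lambda>k. a (M + k)) \<and> (\<forall>k<n. a (M + k) ^ M = - (a 0 ^ M))"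
  using assms(3,4)
proof (induction n)
  case 0
  then show ?case by (simp add: greedy_upto_def)
next
  case (Suc k)
  define b where "b = (\<lambda>k. a (M + k))"
  define w where "w = a 0 ^ M"
  have IH: "greedy_upto k b" "\<And>j. j < k \<Longrightarrow> b j ^ M = - w"
    using Suc greedy_upto_mono[of "M + Suc k" a "M + k"] by (auto simp: b_def w_def)
  have first: "(\<Sum>i<M. norm (x - a i)) = (\<Sum>z | z ^ M = w. norm (x - z))" for x
    unfolding w_def
    by (rule sum_first_block) (use assms(1,2) Suc.prems greedy_upto_mono in \<open>auto\<close>)
  have "norm w = 1"
    using Suc.prems by (simp add: w_def greedy_upto_def norm_power)
  define f where "f x = (\<Sum>j<k. norm (x - b j))" for x
  define V where "V x = (\<Sum>z | z ^ M = w. norm (x - z))" for x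
  define T where "T = 2 / sin (pi / (2 * real M))"
  have V_le: "V x \<le> T" if "norm x = 1" for x
    using sum_dist_roots_less[OF assms(2) that \<open>norm w = 1\<close>]
      sum_dist_roots_at_midpoint[OF assms(2) that, of w] unfolding V_def T_def by fastforce
  have "\<exists>y. norm y = 1 \<and> y ^ M = - w \<and> (\<forall>x. norm x = 1 \<longrightarrow> f x \<le> f y)"
  proof (cases "k = 0")
    case True
    have "card {y. y ^ M = - w} = M"
      using \<open>norm w = 1\<close> assms(2) by (intro card_nth_roots) auto
    then obtain y where y: "y ^ M = - w" using assms(2) by fastforce
    then have "norm y ^ M = 1" using \<open>norm w = 1\<close> by (metis norm_minus_cancel norm_power)
    then have "norm y = 1" using assms(2) power_eq_iff_eq_base[of M "norm y" 1] by simp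
    then show ?thesis using y True by (auto simp: f_def)
  next
    case False
    obtain y where y: "norm y = 1" "\<And>x. norm x = 1 \<Longrightarrow> f x \<le> f y"
      unfolding f_def using sum_dist_attains_max[of b k] by blast
    \<comment> \<open>Appending a maximizer of f to the later points gives a greedy sequence of
      length at most M, so the structural fact locates that maximizer.\<close>
    define b' where "b' = b(k := y)"
    have "greedy_upto k b'"
      using IH(1) by (subst greedy_upto_cong[of _ _ b]) (auto simp: b'_def)
    moreover have "(\<Sum>j<k. norm (x - b' j)) = f x" for x
      unfolding f_def b'_def by (intro sum.cong) auto
    ultimately have "greedy_upto (Suc k) b'"
      using y by (auto simp: greedy_upto_def less_Suc_eq b'_def)
    then have "b' k ^ M = b' 0 ^ M"
      using assms(1) Suc.prems(2) unfolding greedy_in_root_coset_def by blast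
    then show ?thesis using y False IH(2)[of 0] by (auto simp: b'_def)
  qed
  then obtain y where y: "norm y = 1" "y ^ M = - w" "\<And>x. norm x = 1 \<Longrightarrow> f x \<le> f y"
    by blast
  have Vy: "V y = T"
    using sum_dist_roots_at_midpoint[OF assms(2) y(1,2)] by (simp add: V_def T_def)
  have nb: "norm (b k) = 1"
    using Suc.prems by (simp add: greedy_upto_def b_def)
  have tot: "(\<Sum>i<M + k. norm (x - a i)) = V x + f x" for x
    by (simp add: sum_lessThan_add first V_def f_def b_def)
  have "(\<Sum>i<M + k. norm (y - a i)) \<le> (\<Sum>i<M + k. norm (b k - a i))"
    using Suc.prems(1) y(1) unfolding greedy_upto_def b_def by auto
  then have "V y + f y \<le> V (b k) + f (b k)" unfolding tot .
  with V_le[OF nb] y(3)[OF nb] Vy have eq: "V (b k) = T" "f (b k) = f y" by linarith+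
  have "b k ^ M = - w"
    using sum_dist_roots_less[OF assms(2) nb \<open>norm w = 1\<close>] eq(1)
    unfolding V_def T_def by fastforce
  moreover have "greedy_upto (Suc k) b"
    using IH(1) nb y(3) eq(2) by (auto simp: greedy_upto_def less_Suc_eq f_def)
  ultimately show ?case
    using IH(2) unfolding b_def w_def by (auto simp: less_Suc_eq)
qed

text \<open>
  A block of length \<open>2 * M\<close> is a full block of \<open>M\<close> roots followed by midpoints; their \<open>M\<close>-th powers
  are opposite, so the two halves are disjoint and the \<open>2 * M\<close>-th powers agree.
\<close>
lemma greedy_in_root_coset_power2: "greedy_in_root_coset (2 ^ m)"
proof (induction m)
  case 0
  then show ?case by (auto simp: greedy_in_root_coset_def inj_on_def le_Suc_eq)
next
  case (Suc m)
  define M :: nat where "M = 2 ^ m"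
  have M: "greedy_in_root_coset M" "M > 0" using Suc by (auto simp: M_def)
  have "greedy_in_root_coset (2 * M)" unfolding greedy_in_root_coset_def
  proof (intro allI impI)
    fix N a assume N: "N \<le> 2 * M" "greedy_upto N a"
    show "inj_on a {..<N} \<and> (\<forall>k<N. a k ^ (2 * M) = a 0 ^ (2 * M))"
    proof (cases "N \<le> M")
      case True
      then have "inj_on a {..<N} \<and> (\<forall>k<N. a k ^ M = a 0 ^ M)"
        using M(1) N(2) unfolding greedy_in_root_coset_def by blast
      then show ?thesis unfolding mult.commute[of 2 M] power_mult by metis
    next
      case False
      define n where "n = N - M"
      define b where "b = (\<lambda>k. a (M + k))"
      have n: "N = M + n" "n \<le> M" using False N by (auto simp: n_def)
      have *: "greedy_upto n b" "\<And>k. k < n \<Longrightarrow> b k ^ M = - (a 0 ^ M)"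
        using second_block[OF M, of n a] n N by (auto simp: b_def)
      have injb: "inj_on b {..<n}" using M(1) *(1) n(2) unfolding greedy_in_root_coset_def by blast
      have "greedy_upto M a" using N n greedy_upto_mono by auto
      then have **: "inj_on a {..<M}" "\<And>k. k < M \<Longrightarrow> a k ^ M = a 0 ^ M"
        using M(1) unfolding greedy_in_root_coset_def by blast+
      have "a 0 ^ M \<noteq> 0" using N n M(2) by (auto simp: greedy_upto_def)
      have late: "a k ^ M = - (a 0 ^ M)" if "M \<le> k" "k < N" for k
        using *(2)[of "k - M"] that n by (auto simp: b_def)
      have "inj_on a {..<N}"
      proof (rule inj_onI)
        fix i j assume ij: "i \<in> {..<N}" "j \<in> {..<N}" "a i = a j"
        consider "i < M" "j < M" | "M \<le> i" "M \<le> j" | "i < M" "M \<le> j" | "M \<le> i" "j < M"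
          by linarith
        then show "i = j"
        proof cases
          case 1
          then show ?thesis using **(1) ij by (auto dest: inj_onD)
        next
          case 2
          then have "b (i - M) = b (j - M)" using ij by (simp add: b_def)
          then have "i - M = j - M" using injb 2 ij n by (auto dest!: inj_onD)
          then show ?thesis using 2 by simp
        next
          case 3
          then have "a 0 ^ M = - (a 0 ^ M)" using **(2)[of i] late[of j] ij by simp
          then show ?thesis using \<open>a 0 ^ M \<noteq> 0\<close> by simp
        next
          case 4
          then have "a 0 ^ M = - (a 0 ^ M)" using **(2)[of j] late[of i] ij by simp
          then show ?thesis using \<open>a 0 ^ M \<noteq> 0\<close> by simp
        qed
      qed
      moreover have "a k ^ (2 * M) = a 0 ^ (2 * M)" if "k < N" for k
      proof -
        have "a k ^ M = a 0 ^ M \<or> a k ^ M = - (a 0 ^ M)"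
          using **(2)[of k] late[of k] that by (meson leI)
        then show ?thesis by (auto simp: mult.commute[of 2 M] power_mult)
      qed
      ultimately show ?thesis by blast
    qed
  qed
  then show ?case by (simp add: M_def)
qed

section \<open>Splitting the energy at the leading binary block\<close>

lemma H1_eq: "H1 N y = (\<Sum>i<N. \<Sum>j<N. norm (y i - y j))"
proof -
  have "(\<Sum>i<N. \<Sum>j<N. norm (y i - y j)) = (\<Sum>(i, j) \<in> {..<N} \<times> {..<N}. norm (y i - y j))"
    by (rule sum.cartesian_product)
  also have "\<dots> = H1 N y"
    unfolding H1_def by (rule sum.mono_neutral_right) auto
  finally show ?thesis by simp
qed

text \<open>
  The first \<open>2 ^ m\<close> points are all roots, and each later point is a midpoint, so the energy inside the
  first block and the interaction between the two parts have closed forms.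
\<close>
lemma H1_greedy_split:
  assumes "greedy_upto (2 ^ m + n) a" "n \<le> 2 ^ m"
  defines "x \<equiv> pi / (2 * 2 ^ m)"
  shows "H1 (2 ^ m + n) a = 2 * 2 ^ m * cos x / sin x + 4 * real n / sin x + H1 n (\<lambda>k. a (2 ^ m + k))"
proof -
  define M :: nat where "M = 2 ^ m"
  define b where "b k = a (M + k)" for k
  define w where "w = a 0 ^ M"
  have M: "greedy_in_root_coset M" "M > 0" "real M = 2 ^ m" using greedy_in_root_coset_power2 by (auto simp: M_def)
  have gM: "greedy_upto M a" using assms greedy_upto_mono by (auto simp: M_def)
  have na: "norm (a k) = 1" if "k < M + n" for k
    using assms(1) that by (simp add: greedy_upto_def M_def)
  have first: "(\<Sum>j<M. norm (x - a j)) = (\<Sum>z | z ^ M = w. norm (x - z))" for x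
    unfolding w_def by (rule sum_first_block[OF M(1,2) gM])
  have 1: "(\<Sum>j<M. norm (a i - a j)) = 2 * cos x / sin x" if "i < M" for i
  proof -
    have "a i ^ M = w" using first_block(1)[OF M(1,2) gM] that by (auto simp: w_def)
    then show ?thesis
      unfolding first using sum_dist_roots_at_root[OF M(2) na, of i w] that by (simp add: M x_def)
  qed
  have 2: "(\<Sum>j<M. norm (b i - a j)) = 2 / sin x" if "i < n" for i
  proof -
    have "b i ^ M = - w" using second_block[OF M(1,2), of n a] assms(1,2) that by (auto simp: w_def b_def M_def)
    then show ?thesis
      unfolding first using sum_dist_roots_at_midpoint[OF M(2) na, of "M + i" w] that by (simp add: M x_def b_def)
  qed
  have 3: "(\<Sum>i<M. \<Sum>j<n. norm (a i - b j)) = (\<Sum>j<n. \<Sum>i<M. norm (b j - a i))"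
    by (subst sum.swap) (simp add: norm_minus_commute)
  have "H1 (M + n) a = (\<Sum>i<M. \<Sum>j<M. norm (a i - a j)) + (\<Sum>i<M. \<Sum>j<n. norm (a i - b j))
     + ((\<Sum>i<n. \<Sum>j<M. norm (b i - a j)) + (\<Sum>i<n. \<Sum>j<n. norm (b i - b j)))"
    by (simp add: H1_eq sum_lessThan_add sum.distrib b_def)
  also have "\<dots> = 2 * 2 ^ m * cos x / sin x + 4 * real n / sin x + H1 n b"
    unfolding 3 by (simp add: 1 2 M H1_eq)
  finally show ?thesis by (simp add: M_def b_def[abs_def])
qed

section \<open>Cosecant and cotangent near the origin\<close>

lemma cos_ge_quadratic: "1 - x\<^sup>2 / 2 \<le> cos (x::real)"
proof -
  have "\<bar>sin (x / 2)\<bar>\<^sup>2 \<le> \<bar>x / 2\<bar>\<^sup>2"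
    by (intro power_mono abs_sin_x_le_abs_x) auto
  then show ?thesis
    using cos_double_sin[of "x / 2"] by (simp add: power_divide)
qed

lemma sin_ge_cubic:
  assumes "0 \<le> (x::real)"
  shows "x - x ^ 3 / 6 \<le> sin x"
proof -
  have "sin 0 - (0 - 0 ^ 3 / 6) \<le> sin x - (x - x ^ 3 / 6)"
  proof (rule DERIV_nonneg_imp_nondecreasing[OF assms])
    fix y :: real
    show "\<exists>d. ((\<lambda>x. sin x - (x - x ^ 3 / 6)) has_real_derivative d) (at y) \<and> 0 \<le> d"
      using cos_ge_quadratic[of y]
      by (intro exI[of _ "cos y - (1 - y\<^sup>2 / 2)"]) (auto intro!: derivative_eq_intros)
  qed
  then show ?thesis by simp
qed

text \<open>
  Multiplying out, \<open>(1 / x + x / 6 + x ^ 3 / 18) * (x - x ^ 3 / 6)\<close> is at least \<open>1\<close> as soon as \<open>x\<^sup>2 \<le> 3\<close>, which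
  holds up to \<open>pi / 2\<close>. The leading coefficient \<open>1 / 6\<close> is sharp and enters the final constant.
\<close>
lemma cosec_minus_inverse_bounds:
  assumes "0 < (x::real)" "x \<le> pi / 2"
  shows "0 \<le> 1 / sin x - 1 / x" "1 / sin x - 1 / x \<le> x / 6 + x ^ 3 / 18"
proof -
  have s: "sin x > 0" using assms by (intro sin_gt_zero) auto
  show "0 \<le> 1 / sin x - 1 / x"
    using sin_x_le_x[of x] s assms by (simp add: frac_le)
  have x2: "x\<^sup>2 \<le> 3"
  proof -
    have "x\<^sup>2 \<le> (1.6)\<^sup>2" using assms pi_approx by (intro power_mono) auto
    then show ?thesis by (simp add: power2_eq_square)
  qed
  have "1 \<le> (1 / x + x / 6 + x ^ 3 / 18) * (x - x ^ 3 / 6)"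
  proof -
    have "(1 / x + x / 6 + x ^ 3 / 18) * (x - x ^ 3 / 6) = 1 + x ^ 4 * (3 - x\<^sup>2) / 108"
      using assms by (simp add: field_simps power2_eq_square power3_eq_cube power4_eq_xxxx)
    then show ?thesis using x2 assms by simp
  qed
  also have "\<dots> \<le> (1 / x + x / 6 + x ^ 3 / 18) * sin x"
    using sin_ge_cubic[of x] assms by (intro mult_left_mono) auto
  finally show "1 / sin x - 1 / x \<le> x / 6 + x ^ 3 / 18"
    using s by (simp add: field_simps)
qed

text \<open>
  The upper bound follows by differentiating \<open>(3 - x\<^sup>2) * sin x - 3 * x * cos x\<close>: the derivative is
  \<open>x * (sin x - x * cos x)\<close>, and the second factor has derivative \<open>x * sin x\<close>. The coefficient \<open>1 / 3\<close> is
  sharp and enters the final constant; any linear lower bound would do.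
\<close>
lemma cot_minus_inverse_bounds:
  assumes "0 < (x::real)" "x \<le> pi / 2"
  shows "- x \<le> cos x / sin x - 1 / x" "cos x / sin x - 1 / x \<le> - x / 3"
proof -
  have s: "sin x > 0" using assms by (intro sin_gt_zero) auto
  have c: "cos x \<ge> 0" using assms by (intro cos_ge_zero) auto
  have "1 - cos x \<le> x * sin x"
  proof -
    have "1 - cos x \<le> (1 - cos x) * (1 + cos x)"
      using c cos_le_one[of x] mult_left_mono[of 1 "1 + cos x" "1 - cos x"] by simp
    also have "\<dots> = sin x * sin x"
      using sin_cos_squared_add[of x] by (simp add: algebra_simps power2_eq_square)
    also have "\<dots> \<le> x * sin x"
      using sin_x_le_x[of x] s assms by (intro mult_right_mono) auto
    finally show ?thesis .
  qed
  then have "1 / x - cos x / sin x \<le> x" 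
  proof -
    assume h: "1 - cos x \<le> x * sin x"
    have "1 / x \<le> 1 / sin x" using sin_x_le_x[of x] s assms by (simp add: frac_le)
    then have "1 / x - cos x / sin x \<le> (1 - cos x) / sin x" by (simp add: diff_divide_distrib)
    also have "\<dots> \<le> x" using h s by (simp add: field_simps)
    finally show ?thesis .
  qed
  then show "- x \<le> cos x / sin x - 1 / x" by simp
  have "(3 - 0\<^sup>2) * sin 0 - 3 * 0 * cos 0 \<le> (3 - x\<^sup>2) * sin x - 3 * x * cos x"
  proof (rule DERIV_nonneg_imp_nondecreasing[where f = "\<lambda>x. (3 - x\<^sup>2) * sin x - 3 * x * cos x"])
    show "0 \<le> x" using assms by simp
    fix y assume y: "0 \<le> y" "y \<le> x"
    have "0 \<le> sin y - y * cos y"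
    proof -
      have "sin 0 - 0 * cos 0 \<le> sin y - y * cos y"
      proof (rule DERIV_nonneg_imp_nondecreasing[OF y(1)])
        fix u assume "0 \<le> u" "u \<le> y"
        then have "0 \<le> u * sin u" using y assms by (intro mult_nonneg_nonneg sin_ge_zero) auto
        then show "\<exists>d. ((\<lambda>u. sin u - u * cos u) has_real_derivative d) (at u) \<and> 0 \<le> d"
          by (intro exI[of _ "u * sin u"]) (auto intro!: derivative_eq_intros)
      qed
      then show ?thesis by simp
    qed
    then have "0 \<le> y * (sin y - y * cos y)" using y by simp
    then show "\<exists>d. ((\<lambda>x. (3 - x\<^sup>2) * sin x - 3 * x * cos x) has_real_derivative d) (at y) \<and> 0 \<le> d"
      by (intro exI[of _ "y * (sin y - y * cos y)"])
         (auto intro!: derivative_eq_intros simp: algebra_simps power2_eq_square)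
  qed
  then have "3 * x * cos x \<le> (3 - x\<^sup>2) * sin x" by simp
  then show "cos x / sin x - 1 / x \<le> - x / 3"
    using s assms by (simp add: field_simps power2_eq_square)
qed

section \<open>The excess over the continuous energy\<close>

text \<open>
  The numerator of the normalized energy, since the continuous energy is \<open>4 / pi\<close>.
\<close>
definition excess :: "nat \<Rightarrow> (nat \<Rightarrow> complex) \<Rightarrow> real" where
  "excess N y = H1 N y - (real N)\<^sup>2 * (4 / pi)"

text \<open>
  The contribution of one binary digit. With \<open>M = 2 ^ m\<close> and \<open>x = pi / (2 * M)\<close>, the
  leading block contributes
  \<open>2 * M * (cos x / sin x - 1 / x) + 4 * n * (1 / sin x - 1 / x)\<close>. The first term is about \<open>- pi / 3\<close>, the second
  about \<open>(pi / 3) * (n / M)\<close>, and the error is summable over the digits.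
\<close>
lemma excess_greedy_split:
  assumes "greedy_upto (2 ^ m + n) a" "n \<le> 2 ^ m"
  shows "excess n (\<lambda>k. a (2 ^ m + k)) - pi \<le> excess (2 ^ m + n) a" (is ?lower)
    and "excess (2 ^ m + n) a \<le> excess n (\<lambda>k. a (2 ^ m + k))
       - (pi / 3) * (1 - n / 2 ^ m) + (1 / 4) ^ m" (is ?upper)
proof -
  define M :: real where "M = 2 ^ m"
  define x where "x = pi / (2 * M)"
  define e where "e = excess (2 ^ m + n) a - excess n (\<lambda>k. a (2 ^ m + k))"
  have M: "M \<ge> 1" by (simp add: M_def)
  have x: "0 < x" "x \<le> pi / 2" using M by (auto simp: x_def field_simps)
  have invx: "1 / x = 2 * M / pi" by (simp add: x_def)
  have Mx: "M * x = pi / 2" using M by (simp add: x_def)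
  have "e = H1 (2 ^ m + n) a - H1 n (\<lambda>k. a (2 ^ m + k)) - (M\<^sup>2 + 2 * M * n) * (4 / pi)"
    by (simp add: e_def excess_def M_def power2_eq_square algebra_simps)
  also have "\<dots> = 2 * M * (cos x / sin x - 1 / x) + 4 * real n * (1 / sin x - 1 / x)"
    using H1_greedy_split[OF assms] unfolding invx unfolding M_def[symmetric] x_def[symmetric]
    by (simp add: algebra_simps power2_eq_square)
  finally have e: "e = 2 * M * (cos x / sin x - 1 / x) + 4 * real n * (1 / sin x - 1 / x)" .
  have nM: "real n \<le> M" using assms(2) unfolding M_def by (metis of_nat_le_iff of_nat_numeral of_nat_power)
  note b = cosec_minus_inverse_bounds[OF x] cot_minus_inverse_bounds[OF x]
  have "2 * M * (- x) + 4 * real n * 0 \<le> e"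
    unfolding e using b M by (intro add_mono mult_left_mono) auto
  moreover have "2 * M * (- x) + 4 * real n * 0 = - pi" using Mx by simp
  ultimately show ?lower by (simp add: e_def)
  have "e \<le> 2 * M * (- x / 3) + 4 * real n * (x / 6 + x ^ 3 / 18)"
    unfolding e using b M by (intro add_mono mult_left_mono) auto
  also have "\<dots> = - (2 / 3) * (M * x) + (2 / 3) * (M * x) * (n / M) + 4 * real n * (x ^ 3 / 18)"
    using M by (simp add: field_simps)
  also have "\<dots> \<le> - (2 / 3) * (M * x) + (2 / 3) * (M * x) * (n / M) + 4 * M * (x ^ 3 / 18)"
    using nM x by (intro add_left_mono mult_right_mono mult_left_mono) auto
  also have "\<dots> = - (pi / 3) * (1 - n / M) + 4 * (M * x) * (x\<^sup>2 / 18)"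
    unfolding Mx using Mx by (simp add: algebra_simps power3_eq_cube power2_eq_square)
  also have "4 * (M * x) * (x\<^sup>2 / 18) = pi ^ 3 / 36 * (1 / M)\<^sup>2"
    unfolding Mx by (simp add: x_def power_divide power2_eq_square power3_eq_cube)
  also have "\<dots> \<le> 1 * (1 / M)\<^sup>2"
  proof (rule mult_right_mono)
    have "pi ^ 3 \<le> 3.2 ^ 3" using pi_approx by (intro power_mono) auto
    then show "pi ^ 3 / 36 \<le> 1" by (simp add: power3_eq_cube)
  qed auto
  also have "1 * (1 / M)\<^sup>2 = (1 / 4) ^ m"
    using power_mult[of "2::real" 2 m] power_mult[of "2::real" m 2]
    by (simp add: M_def power_divide mult.commute)
  finally show ?upper by (simp add: e_def M_def)
qed

lemma greedy_upto_tail: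
  assumes "greedy_upto (2 ^ m + n) a" "n \<le> 2 ^ m"
  shows "greedy_upto n (\<lambda>k. a (2 ^ m + k))"
  using second_block[OF greedy_in_root_coset_power2 _ assms] by simp

text \<open>
  Every digit contributes at most its summable error, because the remainder \<open>n\<close> is less than \<open>2 ^ m\<close>.
  The bound \<open>2 - 2 * (1 / 4) ^ m\<close> leaves room for one more error at each step.
\<close>
lemma excess_upper:
  assumes "greedy_upto N a" "N < 2 ^ m"
  shows "excess N a \<le> 2 - 2 * (1 / 4) ^ m"
  using assms
proof (induction m arbitrary: N a)
  case 0
  then show ?case by (simp add: excess_def H1_def)
next
  case (Suc m)
  show ?case
  proof (cases "N < 2 ^ m")
    case True
    have "(0::real) \<le> (1 / 4) ^ m" "(1 / 4 :: real) ^ Suc m = (1 / 4) ^ m / 4" by simp_all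
    then show ?thesis using Suc.IH[OF Suc.prems(1) True] by linarith
  next
    case False
    define n where "n = N - 2 ^ m"
    have n: "N = 2 ^ m + n" "n < 2 ^ m" using False Suc.prems by (auto simp: n_def)
    have g: "greedy_upto (2 ^ m + n) a" using Suc.prems n by simp
    have "real n / 2 ^ m \<le> 1" using n(2) by simp
    then have "0 \<le> (pi / 3) * (1 - n / 2 ^ m)" by simp
    then have "excess N a \<le> excess n (\<lambda>k. a (2 ^ m + k)) + (1 / 4) ^ m"
      using excess_greedy_split(2)[OF g] n(2) unfolding n(1) by linarith
    also have "excess n (\<lambda>k. a (2 ^ m + k)) \<le> 2 - 2 * (1 / 4) ^ m"
      using greedy_upto_tail[OF g] n by (intro Suc.IH) auto
    finally have "excess N a \<le> 2 - 2 * (1 / 4) ^ m + (1 / 4) ^ m" by simp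
    moreover have "(0::real) \<le> (1 / 4) ^ m" "(1 / 4 :: real) ^ Suc m = (1 / 4) ^ m / 4" by simp_all
    ultimately show ?thesis by linarith
  qed
qed

lemma excess_lower:
  assumes "greedy_upto N a" "N < 2 ^ m"
  shows "- pi * real m \<le> excess N a"
  using assms
proof (induction m arbitrary: N a)
  case 0
  then show ?case by (simp add: excess_def H1_def)
next
  case (Suc m)
  show ?case
  proof (cases "N < 2 ^ m")
    case True
    then show ?thesis using Suc.IH[OF Suc.prems(1)] by (simp add: algebra_simps) (smt (verit) pi_gt_zero)
  next
    case False
    define n where "n = N - 2 ^ m"
    have n: "N = 2 ^ m + n" "n < 2 ^ m" using False Suc.prems by (auto simp: n_def)
    have g: "greedy_upto (2 ^ m + n) a" using Suc.prems n by simp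
    have "- pi * real m \<le> excess n (\<lambda>k. a (2 ^ m + k))"
      using greedy_upto_tail[OF g] n by (intro Suc.IH) auto
    then show ?thesis using excess_greedy_split(1)[OF g] n by (simp add: algebra_simps)
  qed
qed

lemma excess_power2_lower:
  assumes "greedy_upto (2 ^ m) a"
  shows "- pi \<le> excess (2 ^ m) a"
  using excess_greedy_split(1)[of m 0 a] assms by (simp add: excess_def H1_def)

text \<open>
  The numbers with binary expansion \<open>1010...01\<close>. Sparse digits keep the positive interaction terms
  small, since the remainder after the leading digit is only about a third of that digit, but they
  also halve the number of digits; digits in every second place already yield the constant
  \<open>pi / 9\<close> per binary place.
\<close>
definition alternating :: "nat \<Rightarrow> nat" where
  "alternating k = (\<Sum>j<k. 4 ^ j)"

lemma alternating_Suc: "alternating (Suc k) = 4 ^ k + alternating k"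
  by (simp add: alternating_def)

lemma alternating_bound: "3 * alternating k < 4 ^ k"
  by (induction k) (auto simp: alternating_def)

text \<open>
  Each of the \<open>k\<close> digits contributes at most \<open>- (pi / 3) * (1 - 1 / 3) = - 2 * pi / 9\<close>, up to the summable error.
\<close>
lemma excess_alternating:
  assumes "greedy_upto (alternating k) a"
  shows "excess (alternating k) a \<le> 2 - 2 * (1 / 4) ^ k - (2 * pi / 9) * real k"
  using assms
proof (induction k arbitrary: a)
  case 0
  then show ?case by (simp add: excess_def H1_def alternating_def)
next
  case (Suc k)
  define n where "n = alternating k"
  have p4: "(2::nat) ^ (2 * k) = 4 ^ k" by (simp add: power_mult)
  have p4r: "(2::real) ^ (2 * k) = 4 ^ k" by (simp add: power_mult)
  have A: "alternating (Suc k) = 2 ^ (2 * k) + n" unfolding p4 n_def by (rule alternating_Suc)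
  have n: "n \<le> 2 ^ (2 * k)" using alternating_bound[of k] unfolding p4 n_def by simp
  have g: "greedy_upto (2 ^ (2 * k) + n) a" using Suc.prems unfolding A .
  have "3 * real n < 4 ^ k" using alternating_bound[of k] unfolding n_def
    by (metis of_nat_less_iff of_nat_mult of_nat_numeral of_nat_power)
  then have "real n / 2 ^ (2 * k) \<le> 1 / 3" unfolding p4r by (simp add: field_simps)
  then have "(pi / 3) * (2 / 3) \<le> (pi / 3) * (1 - n / 2 ^ (2 * k))" by (intro mult_left_mono) auto
  moreover have "(1 / 4 :: real) ^ (2 * k) \<le> (1 / 4) ^ k" by (rule power_decreasing) auto
  moreover have "excess n (\<lambda>i. a (2 ^ (2 * k) + i)) \<le> 2 - 2 * (1 / 4) ^ k - (2 * pi / 9) * real k"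
    unfolding n_def by (rule Suc.IH) (use greedy_upto_tail[OF g n] n_def in simp)
  moreover have "(1 / 4 :: real) ^ Suc k = (1 / 4) ^ k / 4" by simp
  moreover have "(0::real) \<le> (1 / 4) ^ k" by simp
  moreover have "(2 * pi / 9) * real (Suc k) = (2 * pi / 9) * real k + (pi / 3) * (2 / 3)"
    by (simp add: algebra_simps)
  ultimately show ?case
    using excess_greedy_split(2)[OF g n] unfolding A by linarith
qed

section \<open>The energy of the uniform measure\<close>

text \<open>
  The point \<open>t = s\<close> splits the circle into two arcs on which the sine has constant sign.
\<close>
lemma integral_chord:
  assumes "0 \<le> s" "s \<le> 2 * pi"
  shows "((\<lambda>t. norm (cis s - cis t)) has_integral 8) {0..2 * pi}"
proof -
  note n = norm_cis_diff[of s]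
  have "((\<lambda>t. 2 * sin ((s - t) / 2)) has_integral (4 * cos ((s - s) / 2) - 4 * cos ((s - 0) / 2))) {0..s}"
    by (rule fundamental_theorem_of_calculus)
       (use assms in \<open>auto intro!: derivative_eq_intros simp: has_real_derivative_iff_has_vector_derivative[symmetric]\<close>)
  then have 1: "((\<lambda>t. norm (cis s - cis t)) has_integral (4 - 4 * cos (s / 2))) {0..s}"
    by (rule has_integral_eq_rhs[OF has_integral_eq, rotated])
       (use assms in \<open>auto simp: n intro!: sin_ge_zero abs_of_nonneg[symmetric]\<close>)
  have "((\<lambda>t. 2 * sin ((t - s) / 2)) has_integral (- 4 * cos ((2 * pi - s) / 2) - - 4 * cos ((s - s) / 2))) {s..2 * pi}"
    by (rule fundamental_theorem_of_calculus)
       (use assms in \<open>auto intro!: derivative_eq_intros simp: has_real_derivative_iff_has_vector_derivative[symmetric]\<close>)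
  moreover have "cos ((2 * pi - s) / 2) = - cos (s / 2)"
    by (simp add: diff_divide_distrib)
  moreover have "norm (cis s - cis t) = 2 * sin ((t - s) / 2)" if "t \<in> {s..2 * pi}" for t
  proof -
    have "sin ((t - s) / 2) \<ge> 0" using that assms by (intro sin_ge_zero) auto
    moreover have "sin ((s - t) / 2) = - sin ((t - s) / 2)"
      by (metis minus_diff_eq minus_divide_left sin_minus)
    ultimately show ?thesis by (simp add: n)
  qed
  ultimately have 2: "((\<lambda>t. norm (cis s - cis t)) has_integral (4 + 4 * cos (s / 2))) {s..2 * pi}"
    using has_integral_eq[of "{s..2 * pi}" "\<lambda>t. 2 * sin ((t - s) / 2)" "\<lambda>t. norm (cis s - cis t)"]
    by (auto simp: add.commute)
  from has_integral_combine[OF assms 1 2] show ?thesis by simp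
qed

text \<open>
  Measurability of \<open>f\<close> on the plane is required apart from continuity along the circle, because in the
  double integral \<open>f\<close> is itself an integral and is known in closed form on the circle only.
\<close>
lemma integral_sigma1:
  fixes f :: "complex \<Rightarrow> real"
  assumes [measurable]: "f \<in> borel_measurable borel"
    and "continuous_on {0..2 * pi} (\<lambda>t. f (cis t))" "((\<lambda>t. f (cis t)) has_integral c) {0..2 * pi}"
  shows "(\<integral>x. f x \<partial>sigma1) = c / (2 * pi)"
proof -
  have [measurable]: "cis \<in> borel_measurable borel"
    by (intro borel_measurable_continuous_onI continuous_intros)
  have "indicator {0..2 * pi} x / emeasure lborel {0..2 * pi} = ennreal (indicator {0..2 * pi} x / (2 * pi))" for x :: real
    using divide_ennreal[of 1 "2 * pi"] by (auto simp: indicator_def)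
  then have "uniform_measure lborel {0..2 * pi} = density lborel (\<lambda>x. ennreal (indicator {0..2 * pi} x / (2 * pi)))"
    unfolding uniform_measure_def by presburger
  then have "(\<integral>x. f x \<partial>sigma1) = (\<integral>t. (indicator {0..2 * pi} t / (2 * pi)) *\<^sub>R f (cis t) \<partial>lborel)"
    unfolding sigma1_def by (subst integral_distr) (auto simp: integral_density)
  also have "\<dots> = (LBINT t:{0..2 * pi}. f (cis t)) / (2 * pi)"
    by (simp add: set_lebesgue_integral_def)
  also have "(LBINT t:{0..2 * pi}. f (cis t)) = c"
    using set_borel_integral_eq_integral(2)[OF borel_integrable_atLeastAtMost'[OF assms(2)]] assms(3)
    by (simp add: integral_unique)
  finally show ?thesis .
qed

lemma sets_sigma1 [measurable_cong, simp]: "sets sigma1 = sets borel"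
  by (simp add: sigma1_def)

lemma finite_measure_sigma1: "finite_measure sigma1"
proof
  have "cis \<in> borel_measurable borel"
    by (intro borel_measurable_continuous_onI continuous_intros)
  then show "emeasure sigma1 (space sigma1) \<noteq> \<infinity>"
    by (simp add: sigma1_def emeasure_distr ennreal_divide_eq_top_iff)
qed

lemma I1_sigma1: "I1 sigma1 = 4 / pi"
proof -
  interpret finite_measure sigma1 by (rule finite_measure_sigma1)
  define F where "F x = (\<integral>y. norm (x - y) \<partial>sigma1)" for x
  have [measurable]: "F \<in> borel_measurable borel"
    unfolding F_def by measurable
  have F: "F (cis s) = 4 / pi" if "s \<in> {0..2 * pi}" for s
    unfolding F_def using integral_sigma1[of "\<lambda>y. norm (cis s - y)" 8] integral_chord[of s] that
    by (force intro!: continuous_intros)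
  have "((\<lambda>t. F (cis t)) has_integral 8) {0..2 * pi}"
    using has_integral_eq[of "{0..2 * pi}" "\<lambda>t. 4 / pi" "\<lambda>t. F (cis t)"]
      has_integral_const_real[of "4 / pi" 0 "2 * pi"] by (simp add: F)
  moreover have "continuous_on {0..2 * pi} (\<lambda>t. F (cis t))"
    using continuous_on_const[of _ "4 / pi"] by (rule continuous_on_eq) (auto simp: F)
  ultimately have "(\<integral>x. F x \<partial>sigma1) = 8 / (2 * pi)" by (intro integral_sigma1) auto
  then show ?thesis by (simp add: I1_def F_def)
qed

section \<open>Logarithmic growth\<close>

lemma greedy_energy_seq_upto: "greedy_energy_seq a \<Longrightarrow> greedy_upto N a"
  unfolding greedy_upto_def
proof (intro allI impI conjI)
  fix n x
  assume a: "greedy_energy_seq a"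
  then show "norm (a n) = 1" by (simp add: greedy_energy_seq_def)
  assume "norm (x :: complex) = 1"
  then show "(\<Sum>k<n. norm (x - a k)) \<le> (\<Sum>k<n. norm (a n - a k))"
    using a by (cases "n = 0") (auto simp: greedy_energy_seq_def)
qed

lemma normalized_energy_eq: "normalized_energy a N = excess N a / ln (real N)"
  by (simp add: normalized_energy_def excess_def I1_sigma1)

text \<open>
  The powers of two show that the limit superior is at least \<open>0\<close>; the numbers \<open>alternating k\<close>,
  whose logarithm is at most \<open>2 * k * ln 2\<close>, give the bound for the limit inferior.
\<close>
theorem theorem3p18:
  fixes a :: "nat \<Rightarrow> complex"
  assumes "greedy_energy_seq a" and "a 0 = 1"
  shows "bounded (normalized_energy a ` {2..})
    \<and> \<not> convergent (normalized_energy a)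
    \<and> limsup (\<lambda>N. ereal (normalized_energy a N)) = 0
    \<and> liminf (\<lambda>N. ereal (normalized_energy a N)) \<le> ereal (- pi / (9 * ln 2))"
proof -
  define f where "f = normalized_energy a"
  have f: "f N = excess N a / ln (real N)" for N
    by (simp add: f_def normalized_energy_eq)
  have g: "greedy_upto N a" for N by (rule greedy_energy_seq_upto[OF assms(1)])
  have up: "excess N a \<le> 2" for N
  proof -
    have "(0::real) \<le> (1 / 4) ^ N" by simp
    then show ?thesis using excess_upper[OF g less_exp, of N] by linarith
  qed
  have ln2: "ln 2 > (0::real)" by simp
  have lnN: "ln 2 \<le> ln (real N)" "0 < ln (real N)" if "N \<ge> 2" for N using that by simp_all
  have f_upper: "f N \<le> 2 / ln (real N)" if "N \<ge> 2" for N
    unfolding f using up lnN(2)[OF that] by (intro divide_right_mono) auto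
  have f_lower: "- 2 * pi / ln 2 \<le> f N" if "N \<ge> 2" for N
  proof -
    define m where "m = floor_log N"
    have m: "2 ^ m \<le> N" "N < 2 ^ Suc m"
      using that floor_log_exp2_le[of N] floor_log_exp2_gt[of N] by (auto simp: m_def)
    \<comment> \<open>At most m + 1 binary digits, each contributing at least - pi.\<close>
    have "m \<ge> 1" using m(2) that by (cases m) auto
    have "real m * ln 2 = ln (2 ^ m)" by (simp add: ln_realpow)
    also have "\<dots> \<le> ln (real N)"
      using m(1) that by (subst ln_le_cancel_iff) (auto simp: numeral_power_le_of_nat_cancel_iff)
    finally have "real m \<le> ln (real N) / ln 2" using ln2 by (simp add: pos_le_divide_eq)
    then have "2 * pi * real m \<le> 2 * pi * (ln (real N) / ln 2)" by (intro mult_left_mono) auto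
    moreover have "pi * real (Suc m) \<le> 2 * pi * real m" using \<open>m \<ge> 1\<close> by simp
    moreover have "- (pi * real (Suc m)) \<le> excess N a" using excess_lower[OF g m(2)] by simp
    ultimately have "- (2 * pi * (ln (real N) / ln 2)) \<le> excess N a" by linarith
    then have "- 2 * pi / ln 2 * ln (real N) \<le> excess N a" by simp
    then show ?thesis unfolding f using lnN(2)[OF that] by (simp only: pos_le_divide_eq)
  qed
  have bdd: "bounded (f ` {2..})"
    unfolding bounded_iff
  proof (intro exI ballI)
    fix y assume "y \<in> f ` {2..}"
    then obtain N where N: "N \<ge> 2" "y = f N" by auto
    have "f N \<le> 2 / ln 2"
      using f_upper[OF N(1)] frac_le[of 2 2 "ln 2" "ln (real N)"] lnN(1)[OF N(1)] by simp
    moreover have "2 / ln 2 \<le> 2 * pi / ln (2::real)" using pi_gt3 by (intro divide_right_mono) auto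
    ultimately show "norm y \<le> 2 * pi / ln 2" using f_lower[OF N(1)] N(2) by (simp add: abs_le_iff)
  qed
  have lim_inv_ln: "(\<lambda>N. c / ln (real N)) \<longlonglongrightarrow> 0" for c
    by real_asymp
  have "limsup (\<lambda>N. ereal (f N)) \<le> limsup (\<lambda>N. ereal (2 / ln (real N)))"
    by (intro Limsup_mono eventually_sequentiallyI[of 2]) (simp add: f_upper)
  also have "\<dots> = 0"
    using lim_inv_ln[of 2] by (intro lim_imp_Limsup) (auto simp: zero_ereal_def)
  finally have ls1: "limsup (\<lambda>N. ereal (f N)) \<le> 0" .
  have sm2: "strict_mono (\<lambda>m. 2 ^ m :: nat)" by (simp add: strict_mono_Suc_iff)
  have "0 = liminf (\<lambda>m. ereal (- pi / ln (real (2 ^ m))))"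
    using LIMSEQ_subseq_LIMSEQ[OF lim_inv_ln[of "- pi"] sm2]
    by (intro lim_imp_Liminf[symmetric]) (auto simp: zero_ereal_def o_def)
  also have "\<dots> \<le> limsup (\<lambda>m. ereal (- pi / ln (real (2 ^ m))))" by (intro Liminf_le_Limsup) simp
  also have "\<dots> \<le> limsup ((\<lambda>N. ereal (f N)) \<circ> (\<lambda>m. 2 ^ m))"
  proof (intro Limsup_mono always_eventually allI)
    fix m
    have "- pi / ln (real (2 ^ m)) \<le> f (2 ^ m)"
      unfolding f using excess_power2_lower[OF g, of m] by (intro divide_right_mono) auto
    then show "ereal (- pi / ln (real (2 ^ m))) \<le> ((\<lambda>N. ereal (f N)) \<circ> (\<lambda>m. 2 ^ m)) m" by simp
  qed
  also have "\<dots> \<le> limsup (\<lambda>N. ereal (f N))" by (rule limsup_subseq_mono[OF sm2])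
  finally have ls: "limsup (\<lambda>N. ereal (f N)) = 0" using ls1 by (rule antisym[rotated])
  have sma: "strict_mono alternating" by (simp add: strict_mono_Suc_iff alternating_Suc)
  have "liminf (\<lambda>N. ereal (f N)) \<le> liminf ((\<lambda>N. ereal (f N)) \<circ> alternating)"
    by (rule liminf_subseq_mono[OF sma])
  also have "\<dots> \<le> liminf (\<lambda>k. ereal ((2 - (2 * pi / 9) * real k) / (2 * real k * ln 2)))"
  proof (intro Liminf_mono eventually_sequentiallyI[of 4])
    fix k :: nat assume k: "4 \<le> k"
    define N where "N = alternating k"
    have "alternating 2 \<le> N"
      unfolding N_def using k strict_mono_less_eq[OF sma] by simp
    then have N2: "N \<ge> 2" by (simp add: alternating_def numeral_2_eq_2)
    have "real (3 * N) < real (4 ^ k)"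
      using alternating_bound[of k] unfolding N_def by (simp only: of_nat_less_iff)
    then have "real N \<le> 4 ^ k" by (simp del: of_nat_le_numeral_power_cancel_iff)
    then have "ln (real N) \<le> ln (4 ^ k)" using N2 by (subst ln_le_cancel_iff) auto
    also have "\<dots> = 2 * real k * ln 2"
      using ln_realpow[of 2 "2 * k"] by (simp add: power_mult)
    finally have lnk: "ln (real N) \<le> 2 * real k * ln 2" .
    \<comment> \<open>Enlarging the denominator increases a quotient only if the numerator is not positive;
      4 \<le> k ensures this.\<close>
    have neg: "2 - (2 * pi / 9) * real k \<le> 0"
    proof -
      have "3 * 4 \<le> pi * real k" using k pi_gt3 by (intro mult_mono) auto
      then show ?thesis by simp
    qed
    have "(0::real) \<le> (1 / 4) ^ k" by simp
    then have "excess N a \<le> 2 - (2 * pi / 9) * real k"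
      using excess_alternating[OF g, of k] unfolding N_def by linarith
    then have "f N \<le> (2 - (2 * pi / 9) * real k) / ln (real N)"
      unfolding f using lnN(2)[OF N2] by (intro divide_right_mono) auto
    also have "\<dots> \<le> (2 - (2 * pi / 9) * real k) / (2 * real k * ln 2)"
      using lnk lnN(2)[OF N2] neg by (intro divide_left_mono_neg) auto
    finally show "((\<lambda>N. ereal (f N)) \<circ> alternating) k \<le> ereal ((2 - (2 * pi / 9) * real k) / (2 * real k * ln 2))"
      by (simp add: N_def)
  qed
  also have "\<dots> = ereal (- pi / (9 * ln 2))"
  proof (intro lim_imp_Liminf)
    have "(\<lambda>k. (2 - (2 * pi / 9) * real k) / (2 * real k * ln 2)) \<longlonglongrightarrow> - pi / (9 * ln 2)"
      by (real_asymp simp: field_simps)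
    then show "(\<lambda>k. ereal ((2 - (2 * pi / 9) * real k) / (2 * real k * ln 2))) \<longlonglongrightarrow> ereal (- pi / (9 * ln 2))"
      by simp
  qed simp
  finally have li: "liminf (\<lambda>N. ereal (f N)) \<le> ereal (- pi / (9 * ln 2))" .
  have "\<not> convergent f"
  proof
    assume "convergent f"
    then obtain l where "f \<longlonglongrightarrow> l" by (auto simp: convergent_def)
    then have "(\<lambda>N. ereal (f N)) \<longlonglongrightarrow> ereal l" by simp
    then have "liminf (\<lambda>N. ereal (f N)) = limsup (\<lambda>N. ereal (f N))"
      using lim_imp_Liminf lim_imp_Limsup by (metis sequentially_bot)
    with li ls have "0 \<le> - pi / (9 * ln (2::real))" by (simp add: zero_ereal_def)
    moreover have "- pi / (9 * ln (2::real)) < 0" using ln2 pi_gt_zero by (simp add: field_simps)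
    ultimately show False by linarith
  qed
  with bdd ls li show ?thesis unfolding f_def by blast
qed

end
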